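(* Let $\{\mathcal{F}_n(x)\}$ be a sequence of generalized Fibonacci polynomials of Fibonacci type with $d(x)=ax+b$, $a\neq0$, and $g(x)$ constant. (1) If $g(x)$ is a positive constant, then there is no measure $\mu$ such that the sequence $\{\mathcal{F}_n(x)\}_{n\ge1}$ is orthogonal with respect to $\mu$. (2) If $g(x)$ is a negative constant, then there exists a measure $\mu$ such that $\{\mathcal{F}_n(x)\}_{n\ge1}$ is orthogonal with respect to $\mu$.
   Context: Given nonzero polynomials $d(x),g(x)\in\mathbb{Q}[x]$ with $\deg d>\deg g$, the generalized Fibonacci polynomials of Fibonacci type are $\mathcal{F}_0(x)=0$, $\mathcal{F}_1(x)=1$, $\mathcal{F}_n(x)=d(x)\mathcal{F}_{n-1}(x)+g(x)\mathcal{F}_{n-2}(x)$ for $n\ge 2$. A measure means a positive Borel measure $\mu$ on $\mathbb{R}$ for which all polynomials are integrable. A sequence of polynomials $\{f_n\}_{n\ge1}$ is orthogonal with respect to $\mu$ if $\int_{\mathbb{R}}f_nf_m\,d\mu=0$ for $n\neq m$ and $\int_{\mathbb{R}}f_n^2\,d\mu\ne0$ for every $n$. *)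

theory Defs
  imports "HOL-Analysis.Analysis" "HOL-Computational_Algebra.Polynomial"
begin

fun fib_poly :: "rat poly \<Rightarrow> rat poly \<Rightarrow> nat \<Rightarrow> rat poly" where
  "fib_poly d g 0 = 0"
| "fib_poly d g (Suc 0) = 1"
| "fib_poly d g (Suc (Suc n)) = d * fib_poly d g (Suc n) + g * fib_poly d g n"

abbreviation real_poly :: "rat poly \<Rightarrow> real poly" where
  "real_poly \<equiv> map_poly of_rat"

text \<open>Measures in the library are nonnegative and may be infinite; integrability of
  the constant polynomials forces finiteness here. The zero measure is not excluded.\<close>

definition poly_measure :: "real measure \<Rightarrow> bool" where
  "poly_measure \<mu> \<longleftrightarrow> sets \<mu> = sets borel \<and> (\<forall>p :: real poly. integrable \<mu> (poly p))"

text \<open>The sequence is indexed by the positive integers; the value at 0 is ignored.\<close>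

definition orthogonal_polys :: "real measure \<Rightarrow> (nat \<Rightarrow> real poly) \<Rightarrow> bool" where
  "orthogonal_polys \<mu> f \<longleftrightarrow>
     (\<forall>n\<ge>1. \<forall>m\<ge>1. n \<noteq> m \<longrightarrow> (LINT x|\<mu>. poly (f n) x * poly (f m) x) = 0) \<and>
     (\<forall>n\<ge>1. (LINT x|\<mu>. (poly (f n) x)\<^sup>2) \<noteq> 0)"

end

theory Submission
  imports Defs
begin

text \<open>For \<^term>\<open>c > 0\<close>, orthogonality of the first and third polynomials would say
  \<open>\<integral>d\<^sup>2 + c \<integral>1 = 0\<close>, impossible for a nonzero positive measure. For \<^term>\<open>c < 0\<close>, put
  \<open>k = sqrt (- c)\<close>; the polynomials are rescaled Chebyshev polynomials of the second kind, with
  \<open>F n * sin t = k ^ (n - 1) * sin (n t)\<close> at the point where \<open>d = 2 k cos t\<close>. Hence the image of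
  the measure \<open>sin\<^sup>2 t dt\<close> on \<open>[0, \<pi>]\<close> under the parametrization
  \<open>t \<mapsto> (2 k cos t - b) / a\<close> makes them orthogonal, by orthogonality of the sines.\<close>

lemma real_poly_simps:
  "real_poly (p * q) = real_poly p * real_poly q"
  "real_poly (p + q) = real_poly p + real_poly q"
proof -
  show "real_poly (p + q) = real_poly p + real_poly q"
    by (intro poly_eqI) (simp add: coeff_map_poly of_rat_add)
  show "real_poly (p * q) = real_poly p * real_poly q"
    by (intro poly_eqI) (simp add: coeff_map_poly coeff_mult of_rat_sum of_rat_mult)
qed

lemma poly_fib_poly_Suc_Suc:
  "poly (real_poly (fib_poly d g (Suc (Suc n)))) x =
     poly (real_poly d) x * poly (real_poly (fib_poly d g (Suc n))) x +
     poly (real_poly g) x * poly (real_poly (fib_poly d g n)) x"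
  by (simp add: real_poly_simps)

text \<open>Both sides satisfy u(n+2) = 2 k cos t * u(n+1) - k^2 * u(n) and agree at n = 0 and n =
  1. The extra factors k and sin t avoid division and the exponent n - 1, so the identity also
  covers n = 0 and the zeros of sin.\<close>

lemma poly_fib_poly_sin:
  assumes "poly (real_poly d) x = 2 * k * cos t" "poly (real_poly g) x = - (k\<^sup>2)"
  shows "k * poly (real_poly (fib_poly d g n)) x * sin t = k ^ n * sin (real n * t)"
proof (induction n rule: induct_nat_012)
  case (ge2 n)
  let ?F = "\<lambda>n. poly (real_poly (fib_poly d g n)) x"
  have sin_rec: "sin (real (Suc (Suc n)) * t) = 2 * cos t * sin (real (Suc n) * t) - sin (real n * t)"
  proof -
    \<comment> \<open>Expanding both sines around (n + 1) t makes the terms with cos((n + 1) t)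
      cancel.\<close>
    have eq: "real (Suc (Suc n)) * t = real (Suc n) * t + t" "real n * t = real (Suc n) * t - t"
      by (simp_all add: algebra_simps)
    show ?thesis
      unfolding eq sin_add sin_diff by simp
  qed
  have "k * ?F (Suc (Suc n)) * sin t =
      2 * k * cos t * (k * ?F (Suc n) * sin t) - k\<^sup>2 * (k * ?F n * sin t)"
    unfolding poly_fib_poly_Suc_Suc assms by (simp add: algebra_simps)
  also have "\<dots> = k ^ Suc (Suc n) * sin (real (Suc (Suc n)) * t)"
    unfolding ge2 sin_rec by (simp add: algebra_simps power2_eq_square)
  finally show ?case .
qed auto

text \<open>For j \<noteq> 0 the antiderivative sin(j t) / j vanishes at both endpoints. The
  frequency is an integer because differences n - m of indices will be substituted.\<close>

lemma has_integral_cos_mult_pi: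
  fixes j :: int
  shows "((\<lambda>t. cos (of_int j * t)) has_integral (if j = 0 then pi else 0)) {0..pi}"
proof (cases "j = 0")
  case True
  then show ?thesis
    using has_integral_const_real[of "1::real" 0 pi] by simp
next
  case False
  have "((\<lambda>t. cos (of_int j * t)) has_integral
      (sin (of_int j * pi) / of_int j - sin (of_int j * 0) / of_int j)) {0..pi}"
  proof (rule fundamental_theorem_of_calculus)
    fix t :: real
    show "((\<lambda>t. sin (of_int j * t) / of_int j) has_vector_derivative cos (of_int j * t))
        (at t within {0..pi})"
      unfolding has_real_derivative_iff_has_vector_derivative[symmetric]
      using False by (auto intro!: derivative_eq_intros)
  qed simp
  moreover have "sin (of_int j * pi) = 0"
    using sin_npi_int[of j] by (simp add: mult.commute)
  ultimately show ?thesis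
    using False by simp
qed

text \<open>Product-to-sum reduces this to cosines of frequencies n - m and n + m; the latter is
  nonzero because the indices are positive, so only n = m contributes.\<close>

lemma has_integral_sin_mult_sin_pi:
  assumes "n \<ge> 1" "m \<ge> 1"
  shows "((\<lambda>t. sin (real n * t) * sin (real m * t)) has_integral (if n = m then pi / 2 else 0))
    {0..pi}"
proof -
  have "((\<lambda>t. (cos (of_int (int n - int m) * t) - cos (of_int (int n + int m) * t)) / 2)
      has_integral ((if int n - int m = 0 then pi else 0) - (if int n + int m = 0 then pi else 0)) / 2)
      {0..pi}"
    by (intro has_integral_divide has_integral_diff has_integral_cos_mult_pi)
  moreover have "(\<lambda>t. (cos (of_int (int n - int m) * t) - cos (of_int (int n + int m) * t)) / 2) =
      (\<lambda>t. sin (real n * t) * sin (real m * t))"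
    by (simp add: sin_times_sin left_diff_distrib distrib_right)
  ultimately show ?thesis
    using assms by (simp split: if_splits)
qed

text \<open>For \<open>\<phi> = cos\<close> this is the Chebyshev weight sqrt(1 - x^2) dx on
  [-1, 1], by x = cos t. As an image measure it turns integrals into integrals over t without a
  change of variables.\<close>

definition chebyshev_measure :: "(real \<Rightarrow> real) \<Rightarrow> real measure" where
  "chebyshev_measure \<phi> =
     distr (density lborel (\<lambda>t. ennreal (indicator {0..pi} t * (sin t)\<^sup>2))) borel \<phi>"

context
  fixes \<phi> f :: "real \<Rightarrow> real"
  assumes cont: "continuous_on UNIV \<phi>" "continuous_on UNIV f"
begin

text \<open>A continuous integrand on a compact interval; this is what makes all polynomials
  integrable.\<close>

lemma set_integrable_chebyshev:
  "set_integrable lborel {0..pi} (\<lambda>t. (sin t)\<^sup>2 * f (\<phi> t))"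
  by (intro borel_integrable_atLeastAtMost' continuous_intros
      continuous_on_compose2[OF cont(2)] continuous_on_subset[OF cont(1)]) auto

lemma borel_measurable_chebyshev: "\<phi> \<in> borel_measurable borel" "f \<in> borel_measurable borel"
  using cont by (auto intro: borel_measurable_continuous_onI)

lemma integrable_chebyshev_measure: "integrable (chebyshev_measure \<phi>) f"
  using set_integrable_chebyshev borel_measurable_chebyshev
  by (simp add: chebyshev_measure_def integrable_distr_eq integrable_real_density
      set_integrable_def mult.assoc)

lemma integral_chebyshev_measure:
  "integral\<^sup>L (chebyshev_measure \<phi>) f = integral {0..pi} (\<lambda>t. (sin t)\<^sup>2 * f (\<phi> t))"
  using set_borel_integral_eq_integral(2)[OF set_integrable_chebyshev] borel_measurable_chebyshev
  by (simp add: chebyshev_measure_def integral_distr integral_real_density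
      set_lebesgue_integral_def mult.assoc)

end

lemma sets_chebyshev_measure: "sets (chebyshev_measure \<phi>) = sets borel"
  by (simp add: chebyshev_measure_def)

lemma fib_poly_not_orthogonal:
  assumes "c > 0" "poly_measure \<mu>"
  shows "\<not> orthogonal_polys \<mu> (\<lambda>n. real_poly (fib_poly d [:c:] n))"
proof
  let ?d = "real_poly d"
  let ?F = "\<lambda>n. real_poly (fib_poly d [:c:] n)"
  assume orth: "orthogonal_polys \<mu> ?F"
  have int: "integrable \<mu> (poly p)" for p :: "real poly"
    using assms(2) by (simp add: poly_measure_def)
  have int_d: "integrable \<mu> (\<lambda>x. (poly ?d x)\<^sup>2)" and int_1: "integrable \<mu> (\<lambda>x. 1 :: real)"
    using int[of "?d\<^sup>2"] int[of 1] by (simp_all add: poly_power[abs_def] poly_1[abs_def])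
  \<comment> \<open>As F 1 = 1 and F 3 = d^2 + c, the first fact concerns the integral of d^2 + c,
    while the second says that the total mass is nonzero, which rules out the zero measure.\<close>
  have "(LINT x|\<mu>. poly (?F 1) x * poly (?F 3) x) = 0" "(LINT x|\<mu>. (poly (?F 1) x)\<^sup>2) \<noteq> 0"
    using orth by (auto simp: orthogonal_polys_def)
  moreover have "poly (?F 1) x * poly (?F 3) x = (poly ?d x)\<^sup>2 + of_rat c * 1" for x
    by (simp add: numeral_3_eq_3 real_poly_simps map_poly_pCons power2_eq_square)
  ultimately have "(LINT x|\<mu>. (poly ?d x)\<^sup>2 + of_rat c * 1) = 0" "(LINT x|\<mu>. 1 :: real) \<noteq> 0"
    by simp_all
  moreover have "(LINT x|\<mu>. (poly ?d x)\<^sup>2 + of_rat c * 1) =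
      (LINT x|\<mu>. (poly ?d x)\<^sup>2) + of_rat c * (LINT x|\<mu>. 1)"
    by (simp only: Bochner_Integration.integral_add[OF int_d integrable_mult_right[OF int_1]]
        integral_mult_right_zero)
  moreover have "(LINT x|\<mu>. (poly ?d x)\<^sup>2) \<ge> 0" "(LINT x|\<mu>. 1 :: real) \<ge> 0"
    by (intro Bochner_Integration.integral_nonneg; simp)+
  moreover have "(of_rat c :: real) > 0"
    using assms by simp
  ultimately show False
    by (smt (verit) mult_pos_pos)
qed

lemma fib_poly_orthogonal:
  assumes "a \<noteq> 0" "c < 0"
  shows "\<exists>\<mu>. poly_measure \<mu> \<and>
    orthogonal_polys \<mu> (\<lambda>n. real_poly (fib_poly [:b, a:] [:c:] n))"
proof -
  define k :: real where "k = sqrt (- of_rat c)"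
  \<comment> \<open>The solution x of a x + b = 2 k cos t.\<close>
  define \<phi> :: "real \<Rightarrow> real" where "\<phi> t = (2 * k * cos t - of_rat b) / of_rat a" for t
  let ?F = "\<lambda>n. real_poly (fib_poly [:b, a:] [:c:] n)"
  let ?\<mu> = "chebyshev_measure \<phi>"
  have c: "(of_rat c :: real) < 0"
    using assms by simp
  then have k: "k > 0" "k\<^sup>2 = - of_rat c"
    by (simp_all add: k_def)
  have \<phi>: "continuous_on UNIV \<phi>"
    unfolding \<phi>_def using assms by (intro continuous_intros) auto
  have F: "k * poly (?F n) (\<phi> t) * sin t = k ^ n * sin (real n * t)" for n t
    using k assms by (intro poly_fib_poly_sin) (simp_all add: \<phi>_def map_poly_pCons)
  \<comment> \<open>The density sin^2 t supplies one factor sin t to each polynomial, turning both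
    into sines by \<open>F\<close>.\<close>
  have FF: "(sin t)\<^sup>2 * (poly (?F n) (\<phi> t) * poly (?F m) (\<phi> t)) =
      k ^ (n + m) / k\<^sup>2 * (sin (real n * t) * sin (real m * t))" for n m t
  proof -
    have "k\<^sup>2 * ((sin t)\<^sup>2 * (poly (?F n) (\<phi> t) * poly (?F m) (\<phi> t))) =
        (k * poly (?F n) (\<phi> t) * sin t) * (k * poly (?F m) (\<phi> t) * sin t)"
      by (simp add: power2_eq_square)
    also have "\<dots> = k ^ (n + m) * (sin (real n * t) * sin (real m * t))"
      unfolding F by (simp add: power_add)
    finally show ?thesis
      using k(1) by (simp add: field_simps)
  qed
  have integral: "(LINT x|?\<mu>. poly (?F n) x * poly (?F m) x) =
      k ^ (n + m) / k\<^sup>2 * (if n = m then pi / 2 else 0)" if "n \<ge> 1" "m \<ge> 1" for n m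
  proof -
    have "(LINT x|?\<mu>. poly (?F n) x * poly (?F m) x) =
        integral {0..pi} (\<lambda>t. k ^ (n + m) / k\<^sup>2 * (sin (real n * t) * sin (real m * t)))"
      by (subst integral_chebyshev_measure[OF \<phi>]) (auto intro!: continuous_intros simp only: FF)
    also have "\<dots> = k ^ (n + m) / k\<^sup>2 * (if n = m then pi / 2 else 0)"
      by (intro integral_unique has_integral_mult_right has_integral_sin_mult_sin_pi that)
    finally show ?thesis .
  qed
  have "poly_measure ?\<mu>"
    unfolding poly_measure_def
    by (auto intro!: sets_chebyshev_measure integrable_chebyshev_measure \<phi> continuous_intros)
  moreover have "orthogonal_polys ?\<mu> ?F"
    \<comment> \<open>Writing the square as a product makes the norm the case n = m of
      \<open>integral\<close>; it is nonzero because k > 0.\<close>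
    using k(1) by (simp add: orthogonal_polys_def integral power2_eq_square[of "poly _ _"])
  ultimately show ?thesis
    by blast
qed

theorem corollary4p5:
  fixes a b c :: rat and d g :: "rat poly"
  assumes "a \<noteq> 0" and "d = [:b, a:]" and "g = [:c:]"
  shows "(c > 0 \<longrightarrow>
      \<not> (\<exists>\<mu>. poly_measure \<mu> \<and> orthogonal_polys \<mu> (\<lambda>n. real_poly (fib_poly d g n)))) \<and>
    (c < 0 \<longrightarrow>
      (\<exists>\<mu>. poly_measure \<mu> \<and> orthogonal_polys \<mu> (\<lambda>n. real_poly (fib_poly d g n))))"
  using assms fib_poly_not_orthogonal fib_poly_orthogonal by blast

end
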